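(* Let $G$ be a finite group containing a normal subgroup $H$ such that $G/H$ is cyclic of prime order $p$. Let $Ht$ be a coset of $H$ in $G$ which generates the quotient group $G/H$. Then the set of non-split conjugacy classes of $G$ may be partitioned into sets of the form \[ \{ g_0^G, g_1^G, \ldots, g_{p-1}^G \} \] where $g_m^G \subseteq Ht^m$ for each $m \in \{0, 1, \ldots, p-1\}$, and the classes $g_0^G, g_1^G, \ldots, g_{p-1}^G$ all commute with one another, that is, $g_i^G \sim g_j^G$ for all $i, j \in \{0, 1, \ldots, p-1\}$.
   Context: All conjugacy classes are conjugacy classes of $G$. Since $G/H$ is abelian, each conjugacy class of $G$ is entirely contained in a single coset of $H$. For $g \in G$ and a subgroup $K \le G$, write $g^K = \{k^{-1} g k : k \in K\}$. A conjugacy class $g^G$ of $G$ is called non-split (with respect to $H$) if $g^G = g^H$, and split otherwise. For conjugacy classes $C, D$ of $G$, write $C \sim D$ (and say that $C$ commutes with $D$) if there exist elements $c \in C$ and $d \in D$ such that $cd = dc$. *)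

theory Defs
  imports
    "HOL-Algebra.Elementary_Groups"
    "HOL-Computational_Algebra.Primes"
    "HOL-Library.Disjoint_Sets"
begin

definition conj_under :: "('a, 'b) monoid_scheme \<Rightarrow> 'a set \<Rightarrow> 'a \<Rightarrow> 'a set"
  where "conj_under G K g = {inv\<^bsub>G\<^esub> k \<otimes>\<^bsub>G\<^esub> g \<otimes>\<^bsub>G\<^esub> k | k. k \<in> K}"

abbreviation conj_class :: "('a, 'b) monoid_scheme \<Rightarrow> 'a \<Rightarrow> 'a set"
  where "conj_class G g \<equiv> conj_under G (carrier G) g"

text \<open>For normal \<open>H\<close>, whether \<open>conj_class G g = conj_under G H g\<close> holds does not depend on the
  choice of the representative \<open>g\<close> of the class.\<close>

definition nonsplit_classes :: "('a, 'b) monoid_scheme \<Rightarrow> 'a set \<Rightarrow> 'a set set"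
  where "nonsplit_classes G H =
    {conj_class G g | g. g \<in> carrier G \<and> conj_class G g = conj_under G H g}"

definition classes_commute :: "('a, 'b) monoid_scheme \<Rightarrow> 'a set \<Rightarrow> 'a set \<Rightarrow> bool"
  where "classes_commute G C D \<longleftrightarrow> (\<exists>c\<in>C. \<exists>d\<in>D. c \<otimes>\<^bsub>G\<^esub> d = d \<otimes>\<^bsub>G\<^esub> c)"

end

theory Submission
  imports Defs "HOL-Algebra.Multiplicative_Group" "HOL-Number_Theory.Cong"
begin

text \<open>
  Two observations produce the partition.

  First, the cosets \<open>Ht\<^sup>m\<close> with \<open>0 < m < p\<close> all look alike. Every class outside \<open>H\<close> is non-split:
  an element \<open>d\<close> outside \<open>H\<close> centralises itself, and its powers meet every coset of \<open>H\<close>, so conjugating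
  \<open>d\<close> by \<open>G\<close> gives nothing beyond conjugating by \<open>H\<close> (\<open>nonsplit_if_commutes_outside\<close>). Choose \<open>e\<close>
  congruent to \<open>m\<close> modulo \<open>p\<close> and coprime to the order of \<open>G\<close>. Then \<open>x \<mapsto> x\<^sup>e\<close> is a permutation of \<open>G\<close>
  that respects conjugacy, so it carries the classes in \<open>Ht\<close> bijectively onto the classes in \<open>Ht\<^sup>m\<close>
  (\<open>nat_pow_bij_betw_levels\<close>). Powers of one element commute, so the \<open>p - 1\<close> classes obtained in this
  way from a class in \<open>Ht\<close> commute with one another; moreover anything commuting with \<open>x\<close> commutes
  with all of its powers.

  It therefore remains to pair off the non-split classes in \<open>H\<close> with the classes in \<open>Ht\<close> so that paired
  classes commute. Weight a pair of classes \<open>C\<close>, \<open>D\<close> by the number of commuting pairs in \<open>C \<times> D\<close>. A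
  non-split class \<open>C\<close> has exactly \<open>|H|\<close> commuting pairs with any given coset of \<open>H\<close>
  (\<open>card_commuting_pairs_coset\<close>), a form of the orbit-stabiliser theorem for \<open>H\<close>. Elements of \<open>H\<close> that
  commute with an element of \<open>Ht\<close> lie in non-split classes, so no commuting pair is lost by looking
  only at non-split classes. Hence all rows and all columns of the matrix of weights have the sum \<open>|H|\<close>,
  and such a matrix supports a perfect matching by Hall's theorem
  (\<open>perfect_matching_of_equal_margins\<close>).
\<close>

section \<open>Matchings in finite bipartite graphs\<close>

text \<open>The induction of Halmos and Vaughan. If some nonempty proper subset \<open>S\<close> of \<open>A\<close> is tight (has only
  as many neighbours as elements), match \<open>S\<close> within its neighbours and the rest outside them; tightness
  is what leaves enough neighbours for the rest. If there is no tight subset, every nonempty proper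
  subset has a neighbour to spare, so one arbitrary edge can be fixed and its end points removed.\<close>

theorem hall_marriage:
  assumes "finite A"
    and "\<And>a. a \<in> A \<Longrightarrow> finite (N a)"
    and "\<And>S. S \<subseteq> A \<Longrightarrow> card S \<le> card (\<Union>(N ` S))"
  shows "\<exists>f. inj_on f A \<and> (\<forall>a\<in>A. f a \<in> N a)"
  using assms
proof (induction "card A" arbitrary: A N rule: less_induct)
  case less
  note fin = less.prems(1) and finN = less.prems(2) and hall = less.prems(3)
  have finU: "finite (\<Union>(N ` S))" if "S \<subseteq> A" for S
    using that fin finN by (meson finite_UN finite_subset subset_iff)
  show ?case
  proof (cases "A = {}")
    case True
    then show ?thesis by simp
  next
    case False
    show ?thesis
    proof (cases "\<exists>S\<subset>A. S \<noteq> {} \<and> card S = card (\<Union>(N ` S))")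
      case True
      then obtain S where S: "S \<subset> A" "S \<noteq> {}" "card S = card (\<Union>(N ` S))"
        by blast
      let ?U = "\<Union>(N ` S)"
      have finS: "finite S" using S(1) fin finite_subset by blast
      have "\<exists>f. inj_on f S \<and> (\<forall>a\<in>S. f a \<in> N a)"
      proof (rule less.hyps)
        show "card S < card A" using S(1) fin by (simp add: psubset_card_mono)
      qed (use S(1) finS finN hall in auto)
      then obtain f where f: "inj_on f S" "\<forall>a\<in>S. f a \<in> N a" by blast
      have "\<exists>g. inj_on g (A - S) \<and> (\<forall>a\<in>A - S. g a \<in> N a - ?U)"
      proof (rule less.hyps)
        show "card (A - S) < card A"
          using S fin by (intro psubset_card_mono) auto
        fix T assume T: "T \<subseteq> A - S"
        have finT: "finite T" using T fin finite_subset by blast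
        have "card T + card S = card (T \<union> S)"
          using T finT finS by (subst card_Un_disjoint) auto
        also have "\<dots> \<le> card (\<Union>(N ` (T \<union> S)))"
          using T S(1) by (intro hall) auto
        also have "\<Union>(N ` (T \<union> S)) = \<Union>((\<lambda>a. N a - ?U) ` T) \<union> ?U" by auto
        also have "card \<dots> \<le> card (\<Union>((\<lambda>a. N a - ?U) ` T)) + card ?U"
          by (rule card_Un_le)
        finally show "card T \<le> card (\<Union>((\<lambda>a. N a - ?U) ` T))"
          using S(3) by linarith
      qed (use fin finN in auto)
      then obtain g where g: "inj_on g (A - S)" "\<forall>a\<in>A - S. g a \<in> N a - ?U" by blast
      define h where "h = (\<lambda>a. if a \<in> S then f a else g a)"
      have "inj_on h A"
      proof (rule inj_onI)
        fix x y assume xy: "x \<in> A" "y \<in> A" "h x = h y"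
        have "x \<in> S \<longleftrightarrow> y \<in> S"
          using xy f(2) g(2) unfolding h_def by (metis DiffD2 DiffI UN_I)
        then show "x = y"
          using xy f(1) g(1) unfolding h_def inj_on_def by (metis DiffI)
      qed
      moreover have "\<forall>a\<in>A. h a \<in> N a"
        using f(2) g(2) by (auto simp: h_def)
      ultimately show ?thesis by blast
    next
      case slack: False
      obtain a where a: "a \<in> A" using False by blast
      have "card {a} \<le> card (\<Union>(N ` {a}))" using a by (intro hall) auto
      then obtain b where b: "b \<in> N a" by fastforce
      have "\<exists>g. inj_on g (A - {a}) \<and> (\<forall>x\<in>A - {a}. g x \<in> N x - {b})"
      proof (rule less.hyps)
        show "card (A - {a}) < card A" using a fin by (intro psubset_card_mono) auto
        fix T assume T: "T \<subseteq> A - {a}"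
        show "card T \<le> card (\<Union>((\<lambda>x. N x - {b}) ` T))"
        proof (cases "T = {}")
          case False
          have "T \<subset> A" using T a by blast
          then have "card T < card (\<Union>(N ` T))"
            using slack False hall[of T] by (metis order_le_less psubset_eq)
          moreover have "\<Union>((\<lambda>x. N x - {b}) ` T) = \<Union>(N ` T) - {b}" by auto
          moreover have "card (\<Union>(N ` T)) \<le> Suc (card (\<Union>(N ` T) - {b}))"
            using card_Suc_Diff1[of "\<Union>(N ` T)" b] finU \<open>T \<subset> A\<close>
            by (cases "b \<in> \<Union>(N ` T)") auto
          ultimately show ?thesis by simp
        qed simp
      qed (use fin finN in auto)
      then obtain g where g: "inj_on g (A - {a})" "\<forall>x\<in>A - {a}. g x \<in> N x - {b}" by blast
      have "inj_on (g(a := b)) A"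
        using g by (auto simp: inj_on_def)
      moreover have "\<forall>x\<in>A. (g(a := b)) x \<in> N x"
        using g b by auto
      ultimately show ?thesis by blast
    qed
  qed
qed

text \<open>A nonnegative matrix with constant row and column sums is a multiple of a doubly stochastic one, and
  its support contains a permutation. A set \<open>S\<close> of rows carries total weight \<open>card S * K\<close>, all of it in
  the columns adjacent to \<open>S\<close>; these columns have capacity \<open>K\<close> each, which is Hall's condition.
  Comparing the total weight by rows and by columns shows that the matrix is square.\<close>

lemma perfect_matching_of_equal_margins:
  fixes w :: "'a \<Rightarrow> 'b \<Rightarrow> nat"
  assumes finA: "finite A" and finB: "finite B" and K: "K > 0"
    and row: "\<And>a. a \<in> A \<Longrightarrow> (\<Sum>b\<in>B. w a b) = K"
    and col: "\<And>b. b \<in> B \<Longrightarrow> (\<Sum>a\<in>A. w a b) = K"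
  shows "\<exists>f. bij_betw f A B \<and> (\<forall>a\<in>A. w a (f a) > 0)"
proof -
  define N where "N a = {b \<in> B. w a b > 0}" for a
  have "\<exists>f. inj_on f A \<and> (\<forall>a\<in>A. f a \<in> N a)"
  proof (rule hall_marriage)
    fix S assume S: "S \<subseteq> A"
    let ?U = "\<Union>(N ` S)"
    have U: "?U \<subseteq> B" by (auto simp: N_def)
    have "card S * K = (\<Sum>a\<in>S. \<Sum>b\<in>B. w a b)"
      using S row by (simp add: subset_iff)
    also have "\<dots> = (\<Sum>a\<in>S. \<Sum>b\<in>?U. w a b)"
      using U finB by (intro sum.cong sum.mono_neutral_right) (auto simp: N_def)
    also have "\<dots> = (\<Sum>b\<in>?U. \<Sum>a\<in>S. w a b)" by (rule sum.swap)
    also have "\<dots> \<le> (\<Sum>b\<in>?U. \<Sum>a\<in>A. w a b)"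
      using S finA by (intro sum_mono sum_mono2) auto
    also have "\<dots> = card ?U * K"
      using U col by (simp add: subset_iff)
    finally show "card S \<le> card ?U" using K by simp
  qed (use finA finB in \<open>auto simp: N_def\<close>)
  then obtain f where f: "inj_on f A" "\<forall>a\<in>A. f a \<in> N a" by blast
  have "card A * K = (\<Sum>a\<in>A. \<Sum>b\<in>B. w a b)" using row by simp
  also have "\<dots> = (\<Sum>b\<in>B. \<Sum>a\<in>A. w a b)" by (rule sum.swap)
  also have "\<dots> = card B * K" using col by simp
  finally have "card (f ` A) = card B" using K f(1) by (simp add: card_image)
  moreover have "f ` A \<subseteq> B" using f(2) by (auto simp: N_def)
  ultimately have "f ` A = B" using finB by (simp add: card_subset_eq)
  then show ?thesis using f by (auto simp: bij_betw_def N_def)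
qed

text \<open>The shape of the final partition: \<open>A\<close> indexes the blocks, and the block of \<open>a\<close> takes one element from
  each of the disjoint sets \<open>B i\<close>.\<close>

lemma partition_on_transversals:
  assumes bij: "\<And>i. i \<in> I \<Longrightarrow> bij_betw (F i) A (B i)"
    and disj: "disjoint_family_on B I" and "I \<noteq> {}"
  shows "partition_on (\<Union>i\<in>I. B i) ((\<lambda>a. (\<lambda>i. F i a) ` I) ` A)"
proof (rule partition_onI)
  show "\<Union>((\<lambda>a. (\<lambda>i. F i a) ` I) ` A) = (\<Union>i\<in>I. B i)"
    using bij by (fastforce simp: bij_betw_def)
  show "{} \<notin> (\<lambda>a. (\<lambda>i. F i a) ` I) ` A" using \<open>I \<noteq> {}\<close> by auto
  fix S T
  assume "S \<in> (\<lambda>a. (\<lambda>i. F i a) ` I) ` A" "T \<in> (\<lambda>a. (\<lambda>i. F i a) ` I) ` A" "S \<noteq> T"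
  then obtain a b where ab: "a \<in> A" "b \<in> A" "S = (\<lambda>i. F i a) ` I" "T = (\<lambda>i. F i b) ` I" "a \<noteq> b"
    by blast
  have "F i a \<noteq> F j b" if ij: "i \<in> I" "j \<in> I" for i j
  proof
    assume eq: "F i a = F j b"
    have "F i a \<in> B i" "F j b \<in> B j"
      using bij ij ab by (auto simp: bij_betw_def)
    then have "i = j"
      using disj eq ij unfolding disjoint_family_on_def by (metis disjoint_iff)
    then show False
      using bij[OF ij(1)] ab eq by (auto simp: bij_betw_def inj_on_def)
  qed
  then show "disjnt S T" using ab by (auto simp: disjnt_def)
qed

section \<open>Exponents invertible modulo the group order\<close>

text \<open>Units modulo \<open>p\<close> lift to units modulo \<open>n\<close>; this replaces an appeal to Dirichlet's theorem on primes in
  arithmetic progressions. Write \<open>n\<close> as a power of \<open>p\<close> times a \<open>q\<close> coprime to \<open>p\<close>, and use the Chinese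
  remainder theorem to choose \<open>e\<close> congruent to \<open>m\<close> modulo \<open>p\<close> and to \<open>1\<close> modulo \<open>q\<close>.\<close>

lemma ex_unit_with_prescribed_residue:
  fixes p n m :: nat
  assumes "prime p" "n > 0" "\<not> p dvd m"
  shows "\<exists>e f. [e = m] (mod p) \<and> [e * f = 1] (mod n)"
proof -
  obtain q where q: "n = p ^ multiplicity p n * q" "\<not> p dvd q"
    using assms by (metis multiplicity_decompose' not_prime_unit neq0_conv)
  have "coprime p q" using assms(1) q(2) by (simp add: prime_imp_coprime)
  then obtain e where e: "[e = m] (mod p)" "[e = 1] (mod q)"
    using binary_chinese_remainder_nat by blast
  have "coprime e p"
    using assms e(1) by (metis cong_dvd_iff coprime_commute prime_imp_coprime)
  moreover have "coprime e q"
    using e(2) by (metis cong_imp_coprime cong_sym coprime_1_left)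
  ultimately have "coprime e n"
    by (subst q(1)) simp
  then show ?thesis
    using e(1) cong_solve_coprime_nat[of e n] by auto
qed

lemma (in group) nat_pow_cong:
  fixes i j n :: nat
  assumes a: "a \<in> carrier G" and n: "a [^] n = \<one>" and ij: "[i = j] (mod n)"
  shows "a [^] i = a [^] j"
proof -
  have red: "a [^] k = a [^] (k mod n)" for k :: nat
  proof -
    have "a [^] k = a [^] (n * (k div n) + k mod n)" by simp
    also have "\<dots> = (a [^] n) [^] (k div n) \<otimes> a [^] (k mod n)"
      using a by (simp only: nat_pow_mult nat_pow_pow)
    finally show ?thesis using a n by simp
  qed
  show ?thesis using red[of i] red[of j] ij by (simp add: cong_def)
qed

section \<open>Conjugation orbits\<close>

context group
begin

lemma conj_by_mult:
  assumes "g \<in> carrier G" "h \<in> carrier G" "k \<in> carrier G"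
  shows "inv k \<otimes> (inv h \<otimes> g \<otimes> h) \<otimes> k = inv (h \<otimes> k) \<otimes> g \<otimes> (h \<otimes> k)"
  using assms by (simp add: inv_mult_group m_assoc)

lemma conj_eq_self_iff:
  assumes "g \<in> carrier G" "k \<in> carrier G"
  shows "inv k \<otimes> g \<otimes> k = g \<longleftrightarrow> g \<otimes> k = k \<otimes> g"
  using assms by (metis inv_solve_left m_assoc inv_closed m_closed)

lemma conj_under_subset:
  "K \<subseteq> carrier G \<Longrightarrow> g \<in> carrier G \<Longrightarrow> conj_under G K g \<subseteq> carrier G"
  by (auto simp: conj_under_def)

lemma conj_under_self:
  assumes "subgroup K G" "g \<in> carrier G"
  shows "g \<in> conj_under G K g"
proof -
  have "g = inv \<one> \<otimes> g \<otimes> \<one>" using assms by simp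
  then show ?thesis
    using subgroup.one_closed[OF assms(1)] unfolding conj_under_def by blast
qed

lemma conj_under_eq:
  assumes K: "subgroup K G" and g: "g \<in> carrier G" and x: "x \<in> conj_under G K g"
  shows "conj_under G K x = conj_under G K g"
proof -
  interpret K: subgroup K G by fact
  have sub: "conj_under G K y \<subseteq> conj_under G K z"
    if z: "z \<in> carrier G" and y: "y \<in> conj_under G K z" for y z
  proof -
    obtain h where h: "h \<in> K" "y = inv h \<otimes> z \<otimes> h" using y by (auto simp: conj_under_def)
    then have "inv k \<otimes> y \<otimes> k = inv (h \<otimes> k) \<otimes> z \<otimes> (h \<otimes> k)" if "k \<in> K" for k
      using that z by (simp add: conj_by_mult)
    then show ?thesis using h(1) unfolding conj_under_def by blast
  qed
  obtain h where h: "h \<in> K" "x = inv h \<otimes> g \<otimes> h" using x by (auto simp: conj_under_def)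
  then have "inv (inv h) \<otimes> x \<otimes> inv h = inv (h \<otimes> inv h) \<otimes> g \<otimes> (h \<otimes> inv h)"
    using g by (simp only: conj_by_mult K.mem_carrier inv_closed)
  then have "g = inv (inv h) \<otimes> x \<otimes> inv h" using g h(1) by simp
  then have "g \<in> conj_under G K x" using h(1) unfolding conj_under_def by blast
  moreover have "x \<in> carrier G" using h g by simp
  ultimately show ?thesis using sub g x by blast
qed

lemma conj_class_self: "g \<in> carrier G \<Longrightarrow> g \<in> conj_class G g"
  by (rule conj_under_self[OF subgroup_self])

lemma conj_class_eq: "g \<in> carrier G \<Longrightarrow> x \<in> conj_class G g \<Longrightarrow> conj_class G x = conj_class G g"
  by (rule conj_under_eq[OF subgroup_self])

text \<open>Non-splitness is a property of the class: it can be read off at every representative.\<close>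

lemma nonsplit_class_rep:
  assumes H: "subgroup H G" and C: "C \<in> nonsplit_classes G H" and x: "x \<in> C"
  shows "x \<in> carrier G" "conj_class G x = C" "conj_under G H x = C"
proof -
  obtain g where g: "g \<in> carrier G" "C = conj_class G g" "C = conj_under G H g"
    using C by (auto simp: nonsplit_classes_def)
  show "x \<in> carrier G" using g x conj_under_subset by blast
  show "conj_class G x = C" using g x conj_class_eq by blast
  show "conj_under G H x = C" using g x conj_under_eq[OF H] by blast
qed

lemma nonsplit_class_nonempty:
  assumes "C \<in> nonsplit_classes G H"
  shows "C \<noteq> {}"
  using assms conj_class_self by (auto simp: nonsplit_classes_def)

lemma nonsplit_class_eqI:
  assumes "subgroup H G" "C \<in> nonsplit_classes G H" "D \<in> nonsplit_classes G H" "x \<in> C" "x \<in> D"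
  shows "C = D"
  using assms nonsplit_class_rep(2) by metis

lemma finite_nonsplit_classes:
  assumes "finite (carrier G)"
  shows "finite (nonsplit_classes G H)"
proof (rule finite_subset)
  show "nonsplit_classes G H \<subseteq> Pow (carrier G)"
    using conj_under_subset[OF subset_refl] by (fastforce simp: nonsplit_classes_def)
qed (use assms in simp)

lemma conj_by_nat_pow:
  fixes e :: nat
  assumes "g \<in> carrier G" "k \<in> carrier G"
  shows "(inv k \<otimes> g \<otimes> k) [^] e = inv k \<otimes> g [^] e \<otimes> k"
proof (induction e)
  case (Suc e)
  have "k \<otimes> (inv k \<otimes> (g \<otimes> k)) = g \<otimes> k"
    using assms by (simp flip: m_assoc)
  then show ?case using Suc assms by (simp add: m_assoc)
qed (use assms in simp)

lemma nat_pow_image_conj_class: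
  fixes e :: nat
  assumes "g \<in> carrier G"
  shows "(\<lambda>x. x [^] e) ` conj_class G g = conj_class G (g [^] e)"
proof -
  have "conj_class G y = (\<lambda>k. inv k \<otimes> y \<otimes> k) ` carrier G" for y
    by (auto simp: conj_under_def)
  then show ?thesis
    using conj_by_nat_pow[OF assms, of _ e] by (simp add: image_image cong: image_cong)
qed

section \<open>Counting commuting pairs\<close>

definition commuting_pairs :: "'a set \<Rightarrow> 'a set \<Rightarrow> ('a \<times> 'a) set"
  where "commuting_pairs C D = {(c, d). c \<in> C \<and> d \<in> D \<and> c \<otimes> d = d \<otimes> c}"

text \<open>Fix \<open>g\<close> in \<open>C\<close>. Each \<open>y\<close> in the coset \<open>Hx\<close> sends \<open>g\<close> to some \<open>c\<close> in \<open>C\<close>. Since \<open>C\<close> is non-split, some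
  \<open>k c\<close> in \<open>H\<close> also conjugates \<open>g\<close> to \<open>c\<close>, and \<open>y\<close> differs from it by the factor \<open>inv (k c) \<otimes> y\<close>, which
  centralises \<open>c\<close> and still lies in \<open>Hx\<close>. So \<open>y\<close> corresponds to the commuting pair
  \<open>(c, inv (k c) \<otimes> y)\<close>, and the number of pairs is the size of \<open>Hx\<close>. This is where it matters that the
  conjugating elements \<open>k c\<close> can be taken from \<open>H\<close>.\<close>

lemma card_commuting_pairs_coset:
  assumes H: "subgroup H G" and C: "C \<in> nonsplit_classes G H" and x: "x \<in> carrier G"
  shows "card (commuting_pairs C (H #> x)) = card H"
proof -
  interpret H: subgroup H G by fact
  obtain g where g: "g \<in> C" using C nonsplit_class_nonempty by blast
  note gC = nonsplit_class_rep[OF H C g]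
  have Cc: "c \<in> carrier G" if "c \<in> C" for c using nonsplit_class_rep(1)[OF H C that] .
  have "\<forall>c\<in>C. \<exists>h\<in>H. inv h \<otimes> g \<otimes> h = c"
    using gC(3) unfolding conj_under_def by auto
  then obtain k where k: "\<And>c. c \<in> C \<Longrightarrow> k c \<in> H" "\<And>c. c \<in> C \<Longrightarrow> inv (k c) \<otimes> g \<otimes> k c = c"
    by metis
  have kG: "k c \<in> carrier G" if "c \<in> C" for c using k(1)[OF that] by simp
  have coset: "h \<otimes> d \<in> H #> x" if "h \<in> H" "d \<in> H #> x" for h d
    using that x by (auto simp: r_coset_def m_assoc[symmetric])
  have cosetG: "d \<in> carrier G" if "d \<in> H #> x" for d
    using that x by (auto simp: r_coset_def)
  have conjC: "inv y \<otimes> g \<otimes> y \<in> C" if "y \<in> H #> x" for y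
    using gC(2) cosetG[OF that] unfolding conj_under_def by auto
  have fwd: "inv (k c \<otimes> d) \<otimes> g \<otimes> (k c \<otimes> d) = c"
    if "c \<in> C" "d \<in> H #> x" "c \<otimes> d = d \<otimes> c" for c d
  proof -
    have "inv (k c \<otimes> d) \<otimes> g \<otimes> (k c \<otimes> d) = inv d \<otimes> (inv (k c) \<otimes> g \<otimes> k c) \<otimes> d"
      using that kG cosetG gC(1) by (simp add: conj_by_mult)
    also have "\<dots> = c"
      using that k(2) Cc cosetG by (simp add: conj_eq_self_iff)
    finally show ?thesis .
  qed
  define c where "c y = inv y \<otimes> g \<otimes> y" for y
  have cC: "c y \<in> C" if "y \<in> H #> x" for y using conjC[OF that] by (simp add: c_def)
  have comm: "c y \<otimes> (inv (k (c y)) \<otimes> y) = (inv (k (c y)) \<otimes> y) \<otimes> c y" if y: "y \<in> H #> x" for y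
  proof -
    let ?k = "k (c y)"
    have kk: "?k \<in> carrier G" "y \<in> carrier G" using kG cC y cosetG by auto
    have "inv (inv ?k \<otimes> y) \<otimes> c y \<otimes> (inv ?k \<otimes> y)
        = inv (inv ?k \<otimes> y) \<otimes> (inv ?k \<otimes> g \<otimes> ?k) \<otimes> (inv ?k \<otimes> y)"
      using k(2)[OF cC[OF y]] by simp
    also have "\<dots> = inv (?k \<otimes> (inv ?k \<otimes> y)) \<otimes> g \<otimes> (?k \<otimes> (inv ?k \<otimes> y))"
      using kk gC(1) by (simp only: conj_by_mult inv_closed m_closed)
    also have "?k \<otimes> (inv ?k \<otimes> y) = y" using kk by (simp flip: m_assoc)
    finally have "inv (inv ?k \<otimes> y) \<otimes> c y \<otimes> (inv ?k \<otimes> y) = c y" by (simp add: c_def)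
    then show ?thesis using kk Cc[OF cC[OF y]] by (simp add: conj_eq_self_iff)
  qed
  let ?P = "commuting_pairs C (H #> x)"
  define merge where "merge = (\<lambda>(a, d). k a \<otimes> d)"
  define split where "split y = (c y, inv (k (c y)) \<otimes> y)" for y
  have "bij_betw merge ?P (H #> x)"
  proof (rule bij_betw_byWitness[where f' = split])
    show "\<forall>q\<in>?P. split (merge q) = q"
    proof
      fix q assume "q \<in> ?P"
      then obtain a d where q: "q = (a, d)" and ad: "a \<in> C" "d \<in> H #> x" "a \<otimes> d = d \<otimes> a"
        by (auto simp: commuting_pairs_def)
      have "c (k a \<otimes> d) = a" using fwd[OF ad] by (simp add: c_def)
      then show "split (merge q) = q"
        using q kG[OF ad(1)] cosetG[OF ad(2)]
        by (simp add: split_def merge_def m_assoc[symmetric])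
    qed
    show "\<forall>y\<in>H #> x. merge (split y) = y"
      using kG cC cosetG by (simp add: split_def merge_def m_assoc[symmetric])
    show "merge ` ?P \<subseteq> H #> x"
      using coset k(1) by (auto simp: merge_def commuting_pairs_def)
    show "split ` (H #> x) \<subseteq> ?P"
      using cC comm coset k(1) by (auto simp: split_def commuting_pairs_def)
  qed
  then have "card ?P = card (H #> x)"
    by (rule bij_betw_same_card)
  also have "\<dots> = card H"
    using card_rcosets_equal[of "H #> x" H] x H.subset rcosetsI by simp
  finally show ?thesis .
qed

lemma card_commuting_pairs_commute: "card (commuting_pairs C D) = card (commuting_pairs D C)"
proof -
  have "prod.swap ` commuting_pairs C D = commuting_pairs D C"
    by (auto simp: commuting_pairs_def image_iff)
  then show ?thesis by (metis card_image inj_swap inj_on_subset subset_UNIV)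
qed

definition nonsplit_classes_within :: "'a set \<Rightarrow> 'a set \<Rightarrow> 'a set set"
  where "nonsplit_classes_within H X = {C \<in> nonsplit_classes G H. C \<subseteq> X}"

text \<open>A row sum of the matrix of weights: the commuting pairs of \<open>C\<close> with the coset are sorted by the
  class of the second component, and \<open>cover\<close> says that this class is always among the non-split ones.\<close>

lemma sum_commuting_pairs:
  assumes H: "subgroup H G" and fin: "finite (carrier G)"
    and C: "C \<in> nonsplit_classes G H" and x: "x \<in> carrier G"
    and cover: "\<And>c d. c \<in> C \<Longrightarrow> d \<in> H #> x \<Longrightarrow> c \<otimes> d = d \<otimes> c
      \<Longrightarrow> \<exists>D\<in>nonsplit_classes_within H (H #> x). d \<in> D"
  shows "(\<Sum>D\<in>nonsplit_classes_within H (H #> x). card (commuting_pairs C D)) = card H"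
proof -
  let ?B = "nonsplit_classes_within H (H #> x)"
  have CG: "C \<subseteq> carrier G" using nonsplit_class_rep(1)[OF H C] by blast
  have BG: "D \<subseteq> carrier G" if "D \<in> ?B" for D
    using that nonsplit_class_rep(1)[OF H] by (auto simp: nonsplit_classes_within_def)
  have finB: "finite ?B"
    using finite_nonsplit_classes[OF fin] by (simp add: nonsplit_classes_within_def)
  have "(\<Sum>D\<in>?B. card (commuting_pairs C D)) = card (\<Union>D\<in>?B. commuting_pairs C D)"
  proof (rule card_UN_disjoint[symmetric])
    show "\<forall>D\<in>?B. finite (commuting_pairs C D)"
    proof
      fix D assume "D \<in> ?B"
      then have "commuting_pairs C D \<subseteq> carrier G \<times> carrier G"
        using CG BG by (auto simp: commuting_pairs_def)
      then show "finite (commuting_pairs C D)" using fin finite_subset by blast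
    qed
    show "\<forall>D\<in>?B. \<forall>E\<in>?B. D \<noteq> E \<longrightarrow> commuting_pairs C D \<inter> commuting_pairs C E = {}"
      using nonsplit_class_eqI[OF H]
      by (auto simp: commuting_pairs_def nonsplit_classes_within_def)
  qed (rule finB)
  also have "(\<Union>D\<in>?B. commuting_pairs C D)
      = commuting_pairs C (H #> x)"
    using cover by (fastforce simp: commuting_pairs_def nonsplit_classes_within_def)
  finally show ?thesis using card_commuting_pairs_coset[OF H C x] by simp
qed

end

section \<open>Cosets in a quotient of prime order\<close>

locale prime_cyclic_extension = normal H G for H and G (structure) +
  fixes t :: 'a and p :: nat
  assumes fin: "finite (carrier G)"
    and order_quotient: "order (G Mod H) = p"
    and prime_p: "prime p"
    and t_closed: "t \<in> carrier G"
    and t_generates: "generate (G Mod H) {H #> t} = carrier (G Mod H)"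
begin

sublocale Q: group "G Mod H"
  by (rule factorgroup_is_group)

lemma subgroup_H: "subgroup H G" ..

lemma coset_in_quotient: "x \<in> carrier G \<Longrightarrow> H #> x \<in> carrier (G Mod H)"
  by (auto simp: carrier_FactGroup)

lemma mem_coset_iff:
  assumes "x \<in> carrier G" "y \<in> carrier G"
  shows "x \<in> H #> y \<longleftrightarrow> H #> x = H #> y"
  using assms repr_independence[OF _ _ subgroup_H] rcos_self[OF _ subgroup_H] by metis

lemma ord_t: "Q.ord (H #> t) = p"
  using Q.generate_pow_card[OF coset_in_quotient[OF t_closed]] t_generates order_quotient
  by (simp add: order_def)

text \<open>In a group of prime order every nontrivial element, here the coset of \<open>x\<close>, is a generator.\<close>

lemma ex_pow_in_coset:
  assumes x: "x \<in> carrier G" "x \<notin> H" and y: "y \<in> carrier G"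
  shows "\<exists>i::nat. y \<in> H #> x [^] i"
proof -
  have xQ: "H #> x \<in> carrier (G Mod H)" using coset_in_quotient x(1) .
  have "H #> x \<noteq> H" using coset_join1[OF _ x(1) subgroup_H] x(2) by blast
  then have "Q.ord (H #> x) \<noteq> 1" using Q.ord_eq_1[OF xQ] by simp
  then have ord: "Q.ord (H #> x) = p"
    using Q.ord_dvd_group_order[OF xQ] order_quotient prime_p by (auto simp: prime_nat_iff)
  have finQ: "finite (carrier (G Mod H))"
    using order_quotient prime_p by (metis Q.order_gt_0_iff_finite prime_gt_0_nat)
  have "generate (G Mod H) {H #> x} = carrier (G Mod H)"
  proof (rule card_subset_eq[OF finQ])
    show "generate (G Mod H) {H #> x} \<subseteq> carrier (G Mod H)"
      using xQ by (intro Q.generate_incl) auto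
    show "card (generate (G Mod H) {H #> x}) = card (carrier (G Mod H))"
      using Q.generate_pow_card[OF xQ] ord order_quotient by (simp add: order_def)
  qed
  moreover have "Q.ord (H #> x) \<noteq> 0" using ord prime_p by auto
  ultimately have "carrier (G Mod H) = {(H #> x) [^]\<^bsub>G Mod H\<^esub> i | i. i \<in> (UNIV :: nat set)}"
    using Q.generate_pow_nat[OF xQ] by simp
  then obtain i :: nat where "H #> y = (H #> x) [^]\<^bsub>G Mod H\<^esub> i"
    using coset_in_quotient[OF y] by auto
  then have "H #> y = H #> x [^] i" using FactGroup_pow x(1) by simp
  then show ?thesis using mem_coset_iff[OF y, of "x [^] i"] x(1) by auto
qed

lemma coset_t_pow_cong:
  fixes i j :: nat
  assumes "[i = j] (mod p)"
  shows "H #> t [^] i = H #> t [^] j"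
  using Q.nat_pow_cong[OF coset_in_quotient[OF t_closed] _ assms]
    Q.pow_ord_eq_1[OF coset_in_quotient[OF t_closed]] ord_t FactGroup_pow[OF t_closed]
  by simp

lemma coset_t_pow_inj: "inj_on (\<lambda>i::nat. H #> t [^] i) {0..p - 1}"
  using Q.ord_inj[OF coset_in_quotient[OF t_closed]] ord_t FactGroup_pow[OF t_closed]
  by simp

lemma t_notin_H: "t \<notin> H"
proof
  assume "t \<in> H"
  then have "H #> t = H" using t_closed by (intro coset_join2[OF _ subgroup_H])
  then have "Q.ord (H #> t) = 1" using Q.ord_id by simp
  then show False using ord_t prime_p by auto
qed

lemma ex_coset_t_pow:
  assumes y: "y \<in> carrier G"
  shows "\<exists>i\<in>{0..p - 1}. y \<in> H #> t [^] i"
proof -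
  obtain i :: nat where "y \<in> H #> t [^] i"
    using ex_pow_in_coset[OF t_closed t_notin_H y] by blast
  moreover have "H #> t [^] i = H #> t [^] (i mod p)"
    by (rule coset_t_pow_cong) (simp add: cong_def)
  moreover have "i mod p \<in> {0..p - 1}"
    using prime_gt_0_nat[OF prime_p] by (auto simp: less_Suc_eq_le[symmetric])
  ultimately show ?thesis by auto
qed

lemma abelian_quotient: "comm_group (G Mod H)"
proof -
  have "carrier (G Mod H) = range (\<lambda>k::int. (H #> t) [^]\<^bsub>G Mod H\<^esub> k)"
    using Q.generate_pow[OF coset_in_quotient[OF t_closed]] t_generates by auto
  then have "cyclic_group (G Mod H)"
    using Q.cyclic_group coset_in_quotient[OF t_closed] by blast
  then show ?thesis by (rule Q.cyclic_imp_abelian_group)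
qed

text \<open>Conjugation is trivial in the abelian quotient.\<close>

lemma conj_class_subset_coset:
  assumes y: "y \<in> carrier G" and x: "x \<in> H #> y"
  shows "conj_class G x \<subseteq> H #> y"
proof
  fix z assume "z \<in> conj_class G x"
  then obtain k where k: "k \<in> carrier G" "z = inv k \<otimes> x \<otimes> k" by (auto simp: conj_under_def)
  interpret Q: comm_group "G Mod H" by (rule abelian_quotient)
  have xG: "x \<in> carrier G" using x y by (auto simp: r_coset_def)
  have "H #> z = (H #> (inv k \<otimes> x)) <#> (H #> k)"
    using k xG by (simp add: rcos_sum)
  also have "\<dots> = (H #> k) <#> (H #> (inv k \<otimes> x))"
    using Q.m_comm[of "H #> (inv k \<otimes> x)" "H #> k"] k xG coset_in_quotient by simp
  also have "\<dots> = H #> x"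
    using k xG by (simp add: rcos_sum m_assoc[symmetric])
  also have "\<dots> = H #> y" using mem_coset_iff x xG y by simp
  finally show "z \<in> H #> y" using mem_coset_iff k xG y by simp
qed

text \<open>The powers of \<open>c\<close> centralise \<open>d\<close> and represent all cosets of \<open>H\<close>, so a conjugating element can be
  changed by a power of \<open>c\<close> until it lies in \<open>H\<close>. The case \<open>c = d\<close> says that classes outside \<open>H\<close> never
  split.\<close>

lemma nonsplit_if_commutes_outside:
  assumes c: "c \<in> carrier G" "c \<notin> H" and d: "d \<in> carrier G" and cd: "c \<otimes> d = d \<otimes> c"
  shows "conj_class G d \<in> nonsplit_classes G H"
proof -
  have "conj_class G d \<subseteq> conj_under G H d"
  proof
    fix z assume "z \<in> conj_class G d"
    then obtain k where k: "k \<in> carrier G" "z = inv k \<otimes> d \<otimes> k" by (auto simp: conj_under_def)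
    obtain i :: nat where "inv k \<in> H #> c [^] i"
      using ex_pow_in_coset c k by blast
    then obtain h where h: "h \<in> H" "inv k = h \<otimes> c [^] i" by (auto simp: r_coset_def)
    let ?c = "c [^] i"
    have hG: "h \<in> carrier G" and cG: "?c \<in> carrier G" using h(1) c by auto
    have "k = inv (h \<otimes> ?c)" using h(2) k(1) by (metis inv_inv)
    then have kk: "k = inv ?c \<otimes> inv h" using hG cG by (simp add: inv_mult_group)
    have comm: "?c \<otimes> d = d \<otimes> ?c"
      using c d cd group_commutes_pow by blast
    have "z = inv (inv ?c \<otimes> inv h) \<otimes> d \<otimes> (inv ?c \<otimes> inv h)" using k(2) kk by simp
    also have "\<dots> = inv (inv h) \<otimes> (inv (inv ?c) \<otimes> d \<otimes> inv ?c) \<otimes> inv h"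
      using hG cG d by (simp only: conj_by_mult inv_closed)
    also have "inv (inv ?c) \<otimes> d \<otimes> inv ?c = d"
      using comm cG d by (simp add: m_assoc)
    finally show "z \<in> conj_under G H d" using h(1) unfolding conj_under_def by blast
  qed
  moreover have "conj_under G H d \<subseteq> conj_class G d"
    using subset unfolding conj_under_def by blast
  ultimately show ?thesis using d by (auto simp: nonsplit_classes_def)
qed

section \<open>Matching the classes in the base group with those in a generating coset\<close>

abbreviation level :: "nat \<Rightarrow> 'a set set"
  where "level m \<equiv> nonsplit_classes_within H (H #> t [^] m)"

lemma notin_H_of_mem_coset_t_pow:
  assumes "m \<in> {0..p - 1}" "m \<noteq> 0" "x \<in> H #> t [^] m"
  shows "x \<notin> H"
proof
  assume "x \<in> H"
  then have "H #> x = H #> t [^] (0::nat)" by (simp add: rcos_const[OF is_group])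
  moreover have "H #> x = H #> t [^] m"
    using assms(3) t_closed \<open>x \<in> H\<close> by (metis mem_coset_iff mem_carrier nat_pow_closed)
  ultimately have "0 = m"
    using assms(1) by (intro inj_onD[OF coset_t_pow_inj]) auto
  then show False using assms(2) by simp
qed

lemma conj_class_in_level:
  assumes "c \<in> carrier G" "c \<notin> H" "d \<in> H #> t [^] (m::nat)" "c \<otimes> d = d \<otimes> c"
  shows "conj_class G d \<in> level m"
proof -
  have "d \<in> carrier G" using assms(3) t_closed elemrcos_carrier is_group nat_pow_closed by blast
  then show ?thesis
    using assms nonsplit_if_commutes_outside[of c d]
      conj_class_subset_coset[OF _ assms(3)] t_closed
    by (auto simp: nonsplit_classes_within_def)
qed

text \<open>Rows are the non-split classes in \<open>H\<close>, columns the classes in \<open>Ht\<close>. Both margins are instances of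
  \<open>sum_commuting_pairs\<close>; in a row the covering condition holds as every element \<open>d\<close> of \<open>Ht\<close>
  commutes with itself, in a column because an element of \<open>H\<close> under consideration commutes with an
  element of \<open>Ht\<close>.\<close>

lemma ex_commuting_matching:
  "\<exists>f. bij_betw f (level 0) (level 1) \<and> (\<forall>C\<in>level 0. classes_commute G C (f C))"
proof -
  have one: "1 \<in> {0..p - 1}" using prime_ge_2_nat[OF prime_p] by simp
  have finL: "finite (level m)" for m
    using finite_nonsplit_classes[OF fin] by (simp add: nonsplit_classes_within_def)
  have outside: "x \<in> carrier G" "x \<notin> H" if "x \<in> H #> t [^] (1::nat)" for x
    using that notin_H_of_mem_coset_t_pow[OF one] t_closed elemrcos_carrier[OF is_group] by auto
  have "\<exists>f. bij_betw f (level 0) (level 1) \<and> (\<forall>C\<in>level 0. card (commuting_pairs C (f C)) > 0)"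
  proof (rule perfect_matching_of_equal_margins)
    show "card H > 0"
      using fin subset subgroup.one_closed[OF subgroup_H]
      by (metis card_gt_0_iff finite_subset empty_iff)
    fix C assume "C \<in> level 0"
    then have C: "C \<in> nonsplit_classes G H" by (simp add: nonsplit_classes_within_def)
    show "(\<Sum>D\<in>level 1. card (commuting_pairs C D)) = card H"
    proof (rule sum_commuting_pairs[OF subgroup_H fin C])
      fix c d assume "d \<in> H #> t [^] (1::nat)"
      then show "\<exists>D\<in>level 1. d \<in> D"
        using conj_class_in_level[of d d 1] outside conj_class_self by blast
    qed (use t_closed in simp)
  next
    fix D assume D1: "D \<in> level 1"
    then have D: "D \<in> nonsplit_classes G H" by (simp add: nonsplit_classes_within_def)
    have "(\<Sum>C\<in>level 0. card (commuting_pairs D C)) = card H"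
    proof (rule sum_commuting_pairs[OF subgroup_H fin D])
      fix d c assume dc: "d \<in> D" "c \<in> H #> t [^] (0::nat)" "d \<otimes> c = c \<otimes> d"
      have "d \<in> H #> t [^] (1::nat)" using dc(1) D1 by (auto simp: nonsplit_classes_within_def)
      then have "conj_class G c \<in> level 0"
        using conj_class_in_level[OF outside dc(2,3)] by blast
      moreover have "c \<in> carrier G" using dc(2) elemrcos_carrier[OF is_group] by auto
      ultimately show "\<exists>C\<in>level 0. c \<in> C" using conj_class_self by blast
    qed simp
    then show "(\<Sum>C\<in>level 0. card (commuting_pairs C D)) = card H"
      by (subst card_commuting_pairs_commute)
  qed (rule finL)+
  moreover have "classes_commute G C D" if "card (commuting_pairs C D) > 0" for C D
    using that by (auto simp: classes_commute_def commuting_pairs_def card_gt_0_iff)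
  ultimately show ?thesis by blast
qed

section \<open>Power maps between cosets\<close>

text \<open>The maps \<open>x \<mapsto> x\<^sup>e\<close> and \<open>x \<mapsto> x\<^sup>f\<close> are mutually inverse on \<open>G\<close>, respect conjugacy, and exchange the
  cosets \<open>Ht\<close> and \<open>Ht\<^sup>m\<close>: as \<open>p\<close> divides the order of \<open>G\<close>, also \<open>m * f\<close> is congruent to \<open>1\<close> modulo \<open>p\<close>.\<close>

lemma nat_pow_bij_betw_levels:
  fixes e f m :: nat
  assumes m: "m \<in> {0..p - 1}" "m \<noteq> 0"
    and e: "[e = m] (mod p)" and ef: "[e * f = 1] (mod order G)"
  shows "bij_betw (\<lambda>C. (\<lambda>x. x [^] e) ` C) (level 1) (level m)"
proof -
  have pdvd: "p dvd order G"
    using lagrange[OF subgroup_H] order_quotient by (metis FactGroup_def dvd_triv_left order_def partial_object.select_convs(1))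
  have efp: "[m * f = 1] (mod p)"
    using e cong_dvd_modulus_nat[OF ef pdvd] by (metis cong_scalar_right cong_sym cong_trans)
  have inverse: "(x [^] e) [^] f = x" "(x [^] f) [^] e = x" if "x \<in> carrier G" for x
    using nat_pow_cong[OF that pow_order_eq_1[OF that] ef] that
    by (simp_all add: nat_pow_pow mult.commute)
  have one: "1 \<in> {0..p - 1}" using prime_ge_2_nat[OF prime_p] by simp
  have pow_coset: "x [^] i \<in> H #> t [^] (j * i)"
    if "x \<in> H #> t [^] j" for x and i j :: nat
  proof -
    have xG: "x \<in> carrier G" using that t_closed elemrcos_carrier is_group nat_pow_closed by blast
    then have "H #> x [^] i = (H #> t [^] j) [^]\<^bsub>G Mod H\<^esub> i"
      using that t_closed FactGroup_pow mem_coset_iff by (metis nat_pow_closed)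
    also have "\<dots> = H #> t [^] (j * i)"
      using t_closed by (simp add: FactGroup_pow nat_pow_pow)
    finally show ?thesis using xG t_closed mem_coset_iff by simp
  qed
  have level_conj: "conj_class G x \<in> level j"
    if "j \<in> {0..p - 1}" "j \<noteq> 0" "x \<in> H #> t [^] j" for x j
    using that notin_H_of_mem_coset_t_pow[OF that] conj_class_in_level[of x x j] t_closed
      elemrcos_carrier[OF is_group] by blast
  have level_rep: "\<exists>x. x \<in> carrier G \<and> x \<in> H #> t [^] j \<and> C = conj_class G x"
    if "C \<in> level j" for C j
    using that conj_class_self by (fastforce simp: nonsplit_classes_within_def nonsplit_classes_def)
  show ?thesis
    unfolding bij_betw_def
  proof (intro conjI equalityI subsetI)
    have "inj_on (\<lambda>x. x [^] e) (carrier G)"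
      using inverse(1) by (rule inj_on_inverseI)
    then have "inj_on (\<lambda>C. (\<lambda>x. x [^] e) ` C) (Pow (carrier G))"
      by (rule inj_on_image_Pow)
    moreover have "level 1 \<subseteq> Pow (carrier G)"
      using nonsplit_class_rep(1)[OF subgroup_H] by (auto simp: nonsplit_classes_within_def)
    ultimately show "inj_on (\<lambda>C. (\<lambda>x. x [^] e) ` C) (level 1)"
      by (rule inj_on_subset)
  next
    fix D assume "D \<in> (\<lambda>C. (\<lambda>x. x [^] e) ` C) ` level 1"
    then obtain x where x: "x \<in> carrier G" "x \<in> H #> t [^] (1::nat)"
        "D = (\<lambda>x. x [^] e) ` conj_class G x"
      using level_rep by blast
    have "x [^] e \<in> H #> t [^] m"
      using pow_coset[OF x(2), of e] coset_t_pow_cong[OF e] by simp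
    then show "D \<in> level m"
      using x nat_pow_image_conj_class level_conj[OF m] by simp
  next
    fix D assume "D \<in> level m"
    then obtain y where y: "y \<in> carrier G" "y \<in> H #> t [^] m" "D = conj_class G y"
      using level_rep by blast
    have "y [^] f \<in> H #> t [^] (1::nat)"
      using pow_coset[OF y(2), of f] coset_t_pow_cong[OF efp] by simp
    then have "conj_class G (y [^] f) \<in> level 1"
      using level_conj[OF one] by simp
    moreover have "(\<lambda>x. x [^] e) ` conj_class G (y [^] f) = D"
      using y inverse(2) by (simp add: nat_pow_image_conj_class)
    ultimately show "D \<in> (\<lambda>C. (\<lambda>x. x [^] e) ` C) ` level 1" by blast
  qed
qed

lemma disjoint_levels: "disjoint_family_on level {0..p - 1}"
  unfolding disjoint_family_on_def
proof (intro ballI impI)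
  fix i j assume ij: "i \<in> {0..p - 1}" "j \<in> {0..p - 1}" "i \<noteq> j"
  show "level i \<inter> level j = {}"
  proof (rule ccontr)
    assume "level i \<inter> level j \<noteq> {}"
    then obtain C where C: "C \<in> nonsplit_classes G H" "C \<subseteq> H #> t [^] i" "C \<subseteq> H #> t [^] j"
      by (auto simp: nonsplit_classes_within_def)
    obtain x where x: "x \<in> C" using nonsplit_class_nonempty[OF C(1)] by blast
    have "H #> t [^] i = H #> t [^] j"
      using x C mem_coset_iff nonsplit_class_rep(1)[OF subgroup_H C(1) x] t_closed
      by (metis nat_pow_closed subsetD)
    then show False using ij inj_onD[OF coset_t_pow_inj] by blast
  qed
qed

lemma Union_levels: "(\<Union>m\<in>{0..p - 1}. level m) = nonsplit_classes G H"
proof (intro equalityI subsetI)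
  fix C assume C: "C \<in> nonsplit_classes G H"
  obtain x where x: "x \<in> C" using nonsplit_class_nonempty[OF C] by blast
  note xC = nonsplit_class_rep[OF subgroup_H C x]
  obtain i where "i \<in> {0..p - 1}" "x \<in> H #> t [^] i" using ex_coset_t_pow[OF xC(1)] by blast
  moreover from this have "C \<subseteq> H #> t [^] i"
    using conj_class_subset_coset[of "t [^] i" x] xC(2) t_closed by simp
  ultimately show "C \<in> (\<Union>m\<in>{0..p - 1}. level m)"
    using C by (auto simp: nonsplit_classes_within_def)
qed (auto simp: nonsplit_classes_within_def)

end

section \<open>The partition of the non-split classes\<close>

theorem theorem2:
  fixes G :: "('a, 'b) monoid_scheme" (structure)
    and H :: "'a set" and t :: 'a and p :: nat
  assumes "group G"
    and "finite (carrier G)"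
    and "H \<lhd> G"
    and "cyclic_group (G Mod H)"
    and "order (G Mod H) = p"
    and "prime p"
    and "t \<in> carrier G"
    and "generate (G Mod H) {H #> t} = carrier (G Mod H)"
  shows "\<exists>P. partition_on (nonsplit_classes G H) P \<and>
    (\<forall>S\<in>P. \<exists>g :: nat \<Rightarrow> 'a.
        (\<forall>m\<in>{0..p - 1}. g m \<in> carrier G) \<and>
        S = (\<lambda>m. conj_class G (g m)) ` {0..p - 1} \<and>
        (\<forall>m\<in>{0..p - 1}. conj_class G (g m) \<subseteq> H #> (t [^] m)) \<and>
        (\<forall>i\<in>{0..p - 1}. \<forall>j\<in>{0..p - 1}.
            classes_commute G (conj_class G (g i)) (conj_class G (g j))))"
proof -
  interpret prime_cyclic_extension H G t p
    using assms by (auto simp: prime_cyclic_extension_def prime_cyclic_extension_axioms_def)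
  let ?I = "{0..p - 1}"
  obtain f where f: "bij_betw f (level 0) (level 1)"
      "\<And>C. C \<in> level 0 \<Longrightarrow> classes_commute G C (f C)"
    using ex_commuting_matching by blast
  obtain a b where ab: "\<And>C. C \<in> level 0 \<Longrightarrow> a C \<in> C \<and> b C \<in> f C \<and> a C \<otimes> b C = b C \<otimes> a C"
    using f(2) unfolding classes_commute_def by metis
  have "\<exists>e f. [e = m] (mod p) \<and> [e * f = 1] (mod order G)" if "m \<in> ?I" "m \<noteq> 0" for m
  proof (rule ex_unit_with_prescribed_residue[OF prime_p])
    show "order G > 0" using fin order_gt_0_iff_finite by blast
    show "\<not> p dvd m" using that by (auto dest: dvd_imp_le)
  qed
  then obtain e e' where e: "\<And>m. m \<in> ?I \<Longrightarrow> m \<noteq> 0 \<Longrightarrow> [e m = m] (mod p)"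
      "\<And>m. m \<in> ?I \<Longrightarrow> m \<noteq> 0 \<Longrightarrow> [e m * e' m = 1] (mod order G)"
    by metis
  \<comment> \<open>The block of \<open>C\<close> consists of \<open>C\<close> and the powers of its partner \<open>f C\<close>; with \<open>a C\<close> and \<open>b C\<close> chosen
    to commute, these representatives commute pairwise on the nose. The exponent \<open>e 1\<close> need not be
    \<open>1\<close>, so the class in \<open>Ht\<close> may differ from \<open>f C\<close>.\<close>
  define g where "g C m = (if m = 0 then a C else b C [^] e m)" for C and m :: nat
  have fl: "f C \<in> level 1" if "C \<in> level 0" for C using f(1) that by (auto simp: bij_betw_def)
  have aC: "a C \<in> carrier G" "conj_class G (a C) = C" if "C \<in> level 0" for C
    using that ab[OF that] nonsplit_class_rep[OF subgroup_H, of C "a C"]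
    by (auto simp: nonsplit_classes_within_def)
  have bC: "b C \<in> carrier G" "conj_class G (b C) = f C" if "C \<in> level 0" for C
    using that ab[OF that] fl[OF that] nonsplit_class_rep[OF subgroup_H, of "f C" "b C"]
    by (auto simp: nonsplit_classes_within_def)
  have gG: "g C m \<in> carrier G" if "C \<in> level 0" for C m
    using aC bC that by (simp add: g_def)
  have bij: "bij_betw (\<lambda>C. conj_class G (g C m)) (level 0) (level m)" if m: "m \<in> ?I" for m
  proof (cases "m = 0")
    case True
    have "bij_betw (\<lambda>C. conj_class G (g C m)) (level 0) (level 0) \<longleftrightarrow> bij_betw id (level 0) (level 0)"
      using aC True by (intro bij_betw_cong) (simp add: g_def)
    then show ?thesis using True by simp
  next
    case False
    have "bij_betw ((\<lambda>C. (\<lambda>x. x [^] e m) ` C) \<circ> f) (level 0) (level m)"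
      using f(1) nat_pow_bij_betw_levels[OF m False e(1)[OF m False] e(2)[OF m False]]
      by (rule bij_betw_trans)
    moreover have "((\<lambda>C. (\<lambda>x. x [^] e m) ` C) \<circ> f) C = conj_class G (g C m)" if "C \<in> level 0" for C
      using nat_pow_image_conj_class[OF bC(1)[OF that]] bC(2)[OF that] False
      by (simp add: g_def)
    ultimately show ?thesis by (rule bij_betw_cong[THEN iffD1, rotated])
  qed
  have comm: "g C i \<otimes> g C j = g C j \<otimes> g C i" if C: "C \<in> level 0" for C i j
  proof -
    have "a C \<otimes> b C [^] n = b C [^] n \<otimes> a C" for n :: nat
      using ab[OF C] aC[OF C] bC[OF C] group_commutes_pow by metis
    then show ?thesis using nat_pow_comm[OF bC(1)[OF C]] by (simp add: g_def)
  qed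
  let ?P = "(\<lambda>C. (\<lambda>m. conj_class G (g C m)) ` ?I) ` level 0"
  have witness: "\<exists>g :: nat \<Rightarrow> 'a.
        (\<forall>m\<in>?I. g m \<in> carrier G) \<and>
        S = (\<lambda>m. conj_class G (g m)) ` ?I \<and>
        (\<forall>m\<in>?I. conj_class G (g m) \<subseteq> H #> (t [^] m)) \<and>
        (\<forall>i\<in>?I. \<forall>j\<in>?I. classes_commute G (conj_class G (g i)) (conj_class G (g j)))"
    if S: "S \<in> ?P" for S
  proof -
    obtain C where C: "C \<in> level 0" "S = (\<lambda>m. conj_class G (g C m)) ` ?I"
      using S by blast
    show ?thesis
    proof (intro exI[of _ "g C"] conjI ballI)
      show "S = (\<lambda>m. conj_class G (g C m)) ` ?I" by (rule C(2))
      show "g C m \<in> carrier G" for m using gG[OF C(1)] .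
      show "conj_class G (g C m) \<subseteq> H #> t [^] m" if "m \<in> ?I" for m
        using bij[OF that] C(1) by (auto simp: bij_betw_def nonsplit_classes_within_def)
      show "classes_commute G (conj_class G (g C i)) (conj_class G (g C j))" for i j
        using comm[OF C(1)] conj_class_self[OF gG[OF C(1)]] unfolding classes_commute_def by blast
    qed
  qed
  have "partition_on (nonsplit_classes G H) ?P"
    using partition_on_transversals[of ?I "\<lambda>m C. conj_class G (g C m)", OF bij disjoint_levels]
    unfolding Union_levels by auto
  then show ?thesis using witness by blast
qed

end
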